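(* There exists a real constant $c>0$ such that for every integer $r\geq 2$ there is an integer $N_0$ (which may depend on $r$) such that for all integers $N\geq N_0$, $$\mathrm{ex}_r(N,6)\;\geq\; N^{\frac{11}{8}-\frac{c}{\sqrt{\log_2 N}}}.$$
   Context: A hypergraph is a pair $\mathcal{H}=(V,E)$ of finite sets, where $V$ is the set of vertices and $E$ (the set of edges) is a set of nonempty subsets of $V$ (so no multiple edges). It is $r$-uniform if every edge has exactly $r$ vertices. Isolated vertices (contained in no edge) are allowed. A cycle of length $k\geq 2$ in $\mathcal{H}$ is a pair of sequences of $k$ distinct vertices $v_0,\ldots,v_{k-1}$ and $k$ distinct edges $e_0,\ldots,e_{k-1}$ such that $\{v_i,v_{i+1}\}\subseteq e_i$ for $0\leq i\leq k-1$, with indices reduced modulo $k$. The girth of $\mathcal{H}$ is the minimum length of a cycle in it; "girth at least $g$" means that $\mathcal{H}$ has no cycle of length $k$ with $2\leq k<g$ (in particular a hypergraph with no cycles satisfies this). $\mathrm{ex}_r(N,g)$ denotes the maximum number of edges in an $r$-uniform hypergraph on $N$ vertices with girth at least $g$. *)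

theory Defs
  imports Complex_Main "HOL-Library.Extended_Nat"
begin

definition hypergraph :: "'a set \<Rightarrow> 'a set set \<Rightarrow> bool" where
  "hypergraph V E \<longleftrightarrow> finite V \<and> (\<forall>e\<in>E. e \<subseteq> V \<and> e \<noteq> {})"

definition uniform :: "nat \<Rightarrow> 'a set set \<Rightarrow> bool" where
  "uniform r E \<longleftrightarrow> (\<forall>e\<in>E. card e = r)"

text \<open>
  Only the values of \<open>v\<close> and \<open>e\<close> on \<open>{..<k}\<close> matter. The edges determine the cycles,
  so the vertex set is not an argument.
\<close>

definition is_cycle :: "'a set set \<Rightarrow> nat \<Rightarrow> (nat \<Rightarrow> 'a) \<Rightarrow> (nat \<Rightarrow> 'a set) \<Rightarrow> bool" where
  "is_cycle E k v e \<longleftrightarrow>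
     k \<ge> 2 \<and> inj_on v {..<k} \<and> inj_on e {..<k} \<and>
     (\<forall>i<k. e i \<in> E \<and> {v i, v ((i + 1) mod k)} \<subseteq> e i)"

text \<open>The girth is \<open>\<infinity>\<close>, the infimum of the empty set, if there is no cycle.\<close>

definition girth :: "'a set set \<Rightarrow> enat" where
  "girth E = Inf {enat k | k. \<exists>v e. is_cycle E k v e}"

lemma girth_ge_iff:
  "enat g \<le> girth E \<longleftrightarrow> (\<forall>k. 2 \<le> k \<and> k < g \<longrightarrow> \<not> (\<exists>v e. is_cycle E k v e))"
proof -
  have "enat g \<le> girth E \<longleftrightarrow> (\<forall>k v e. is_cycle E k v e \<longrightarrow> g \<le> k)"
    unfolding girth_def le_Inf_iff by (auto simp del: enat_ord_simps(1)) (metis enat_ord_simps(1))+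
  also have "\<dots> \<longleftrightarrow> (\<forall>k. 2 \<le> k \<and> k < g \<longrightarrow> \<not> (\<exists>v e. is_cycle E k v e))"
    by (metis is_cycle_def not_le)
  finally show ?thesis .
qed

text \<open>
  Every hypergraph is isomorphic to one whose vertices are natural numbers, so the
  restriction to this vertex type does not change the maximum.
\<close>

definition edge_counts :: "nat \<Rightarrow> nat \<Rightarrow> nat \<Rightarrow> nat set" where
  "edge_counts r N g =
     {card E | (V :: nat set) E.
        hypergraph V E \<and> card V = N \<and> uniform r E \<and> enat g \<le> girth E}"

definition ex :: "nat \<Rightarrow> nat \<Rightarrow> nat \<Rightarrow> nat" where
  "ex r N g = Max (edge_counts r N g)"

text \<open>The maximum is over a finite nonempty set, hence attained.\<close>

lemma finite_edge_counts: "finite (edge_counts r N g)"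
proof (rule finite_subset)
  show "edge_counts r N g \<subseteq> {..2 ^ N}"
  proof
    fix m assume "m \<in> edge_counts r N g"
    then obtain V :: "nat set" and E where
      VE: "m = card E" "hypergraph V E" "card V = N"
      unfolding edge_counts_def by blast
    have "finite V" "E \<subseteq> Pow V" using VE(2) by (auto simp: hypergraph_def)
    then have "card E \<le> card (Pow V)" by (intro card_mono) auto
    then show "m \<in> {..2 ^ N}" using VE \<open>finite V\<close> by (simp add: card_Pow)
  qed
qed simp

lemma edge_counts_nonempty: "edge_counts r N g \<noteq> {}"
proof -
  have "hypergraph {..<N} {}" "uniform r {}" "enat g \<le> girth ({} :: nat set set)"
    by (auto simp: hypergraph_def uniform_def girth_ge_iff is_cycle_def intro!: exI[of _ 0])
  then have "card ({} :: nat set set) \<in> edge_counts r N g"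
    unfolding edge_counts_def by (metis (mono_tags, lifting) card_lessThan mem_Collect_eq)
  then show ?thesis by blast
qed

end

theory Submission
  imports Defs "HOL-Algebra.Algebraic_Closure_Type" "HOL-Library.Z2"
begin

text \<open>
  Let \<open>q = 2 ^ m\<close>. The affine part of the twisted triality hexagon of order \<open>(q, q\<^sup>3)\<close> has \<open>q ^ 9\<close> points
  and \<open>q ^ 11\<close> lines of \<open>q\<close> points each, and distinct lines never form a cycle of length at most 5.
  Replacing every line by a copy of an extremal hypergraph on \<open>q\<close> vertices keeps the girth
  at least 6, so \<open>ex r (q ^ 9) 6 \<ge> q ^ 11 * ex r q 6\<close>; the exponent \<open>11/8\<close> is the fixed point of
  \<open>9 \<alpha> = 11 + \<alpha>\<close>. Iterating over powers of two gives the bound.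

  Over the cubic extension \<open>K\<close> of \<open>F\<close>, points form the Heisenberg group on \<open>F + K + K + F\<close>, and lines
  are cosets of one-parameter subgroups in the directions \<open>(1, s, adj s, nrm s)\<close>. A short cycle of
  lines gives a vanishing combination of at most five such directions. Four distinct ones are
  independent, and a dependence of five, or a commuting pattern of length four, is excluded by
  the central coordinate.
\<close>

section \<open>Hypergraphs under injective maps\<close>

text \<open>Every vertex of a cycle lies in one of its edges, so the inverse of \<open>f\<close> on
  \<open>\<Union>E\<close> pulls the whole cycle back.\<close>

lemma is_cycle_image:
  assumes "is_cycle ((`) f ` E) k v e" "inj_on f (\<Union>E)"
  shows "\<exists>v' e'. is_cycle E k v' e'"
proof -
  let ?g = "inv_into (\<Union>E) f"
  have e: "?g ` f ` d = d" if "d \<in> E" for d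
    using assms(2) that by (intro inv_into_image_cancel) auto
  have "inj_on ?g (f ` \<Union>E)" by (rule inj_on_inv_into) simp
  moreover have v: "v i \<in> f ` \<Union>E" if "i < k" for i
    using assms(1) that unfolding is_cycle_def by fastforce
  ultimately have "inj_on (?g \<circ> v) {..<k}"
    using assms(1) unfolding is_cycle_def by (intro comp_inj_on) (auto intro: inj_on_subset)
  moreover have "\<exists>d\<in>E. e i = f ` d" if "i < k" for i
    using assms(1) that unfolding is_cycle_def by fastforce
  then obtain d where d: "\<And>i. i < k \<Longrightarrow> d i \<in> E \<and> e i = f ` d i" by metis
  moreover have "inj_on d {..<k}"
    using assms(1) d unfolding is_cycle_def inj_on_def by (metis lessThan_iff)
  moreover have "{?g (v i), ?g (v ((i + 1) mod k))} \<subseteq> d i" if "i < k" for i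
  proof -
    have "{v i, v ((i + 1) mod k)} \<subseteq> f ` d i"
      using assms(1) that d[OF that] unfolding is_cycle_def by auto
    then have "?g ` {v i, v ((i + 1) mod k)} \<subseteq> ?g ` f ` d i" by (rule image_mono)
    then show ?thesis using e d[OF that] by simp
  qed
  ultimately show ?thesis
    using assms(1) unfolding is_cycle_def by (intro exI[of _ "?g \<circ> v"] exI[of _ d]) auto
qed

lemma girth_image_ge:
  assumes "enat g \<le> girth E" "inj_on f (\<Union>E)"
  shows "enat g \<le> girth ((`) f ` E)"
  using assms is_cycle_image unfolding girth_ge_iff by metis

lemma uniform_image:
  assumes "uniform r E" "inj_on f (\<Union>E)"
  shows "uniform r ((`) f ` E)"
  unfolding uniform_def
proof
  fix d assume "d \<in> (`) f ` E"
  then obtain e where e: "e \<in> E" "d = f ` e" by blast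
  have "inj_on f e" using assms(2) e(1) by (rule inj_on_subset[OF _ Union_upper])
  then show "card d = r" using assms(1) e by (simp add: card_image uniform_def)
qed

section \<open>Twisted tensor cubes over a cyclic cubic extension\<close>

locale cubic_extension =
  fixes \<sigma> :: "'a::field \<Rightarrow> 'a" and K :: "'a set"
  assumes \<sigma>_add: "\<sigma> (x + y) = \<sigma> x + \<sigma> y"
    and \<sigma>_mult: "\<sigma> (x * y) = \<sigma> x * \<sigma> y"
    and \<sigma>_one: "\<sigma> 1 = 1"
    and K_add: "x \<in> K \<Longrightarrow> y \<in> K \<Longrightarrow> x + y \<in> K"
    and K_mult: "x \<in> K \<Longrightarrow> y \<in> K \<Longrightarrow> x * y \<in> K"
    and K_uminus: "x \<in> K \<Longrightarrow> - x \<in> K"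
    and K_inverse: "x \<in> K \<Longrightarrow> inverse x \<in> K"
    and K_one: "1 \<in> K"
    and K_\<sigma>: "x \<in> K \<Longrightarrow> \<sigma> x \<in> K"
    and \<sigma>3: "x \<in> K \<Longrightarrow> \<sigma> (\<sigma> (\<sigma> x)) = x"
begin

section \<open>Fixed field, trace, adjoint and norm\<close>

definition F :: "'a set" where "F = {x \<in> K. \<sigma> x = x}"

definition tr :: "'a \<Rightarrow> 'a" where "tr x = x + \<sigma> x + \<sigma> (\<sigma> x)"

text \<open>The quadratic adjoint of the cubic norm: \<open>x * adj x = nrm x\<close>.\<close>

definition adj :: "'a \<Rightarrow> 'a" where "adj x = \<sigma> x * \<sigma> (\<sigma> x)"

definition nrm :: "'a \<Rightarrow> 'a" where "nrm x = x * \<sigma> x * \<sigma> (\<sigma> x)"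

lemma \<sigma>_zero [simp]: "\<sigma> 0 = 0"
  using \<sigma>_add[of 0 0] by (metis add_cancel_right_left)

lemma \<sigma>_uminus: "\<sigma> (- x) = - \<sigma> x"
  using \<sigma>_add[of x "- x"] by (simp add: eq_neg_iff_add_eq_0 add.commute)

lemma \<sigma>_diff: "\<sigma> (x - y) = \<sigma> x - \<sigma> y"
  using \<sigma>_add[of x "- y"] by (simp add: \<sigma>_uminus)

lemma \<sigma>_eq_0_iff [simp]: "\<sigma> x = 0 \<longleftrightarrow> x = 0"
proof
  assume "\<sigma> x = 0"
  show "x = 0"
  proof (rule ccontr)
    assume "x \<noteq> 0"
    then have "1 = \<sigma> x * \<sigma> (inverse x)" by (simp add: \<sigma>_one flip: \<sigma>_mult)
    then show False using \<open>\<sigma> x = 0\<close> by simp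
  qed
qed simp

lemma \<sigma>_inverse: "\<sigma> (inverse x) = inverse (\<sigma> x)"
proof (cases "x = 0")
  case False
  then have "\<sigma> x * \<sigma> (inverse x) = 1" by (simp add: \<sigma>_one flip: \<sigma>_mult)
  then show ?thesis by (metis inverse_unique)
qed simp

lemma \<sigma>_divide: "\<sigma> (x / y) = \<sigma> x / \<sigma> y"
  by (simp add: divide_inverse \<sigma>_mult \<sigma>_inverse)

lemma \<sigma>_sum: "\<sigma> (\<Sum>i\<in>I. f i) = (\<Sum>i\<in>I. \<sigma> (f i))"
  by (induction I rule: infinite_finite_induct) (auto simp: \<sigma>_add)

lemmas \<sigma>_simps = \<sigma>_add \<sigma>_mult \<sigma>_one \<sigma>_uminus \<sigma>_diff \<sigma>_divide \<sigma>_inverse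

lemma K_diff: "x \<in> K \<Longrightarrow> y \<in> K \<Longrightarrow> x - y \<in> K"
  using K_add[of x "- y"] K_uminus by simp

lemma K_divide: "x \<in> K \<Longrightarrow> y \<in> K \<Longrightarrow> x / y \<in> K"
  by (simp add: divide_inverse K_mult K_inverse)

lemma K_zero: "0 \<in> K"
  using K_diff[OF K_one K_one] by simp

lemmas K_intros = K_zero K_one K_add K_mult K_uminus K_diff K_divide K_inverse K_\<sigma>

lemma F_K: "x \<in> F \<Longrightarrow> x \<in> K" and F_\<sigma>: "x \<in> F \<Longrightarrow> \<sigma> x = x"
  by (auto simp: F_def)

lemma F_add: "x \<in> F \<Longrightarrow> y \<in> F \<Longrightarrow> x + y \<in> F"
  and F_mult: "x \<in> F \<Longrightarrow> y \<in> F \<Longrightarrow> x * y \<in> F"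
  and F_uminus: "x \<in> F \<Longrightarrow> - x \<in> F"
  and F_diff: "x \<in> F \<Longrightarrow> y \<in> F \<Longrightarrow> x - y \<in> F"
  and F_divide: "x \<in> F \<Longrightarrow> y \<in> F \<Longrightarrow> x / y \<in> F"
  by (auto simp: F_def K_intros \<sigma>_simps)

lemma tr_F: "x \<in> K \<Longrightarrow> tr x \<in> F" and nrm_F: "x \<in> K \<Longrightarrow> nrm x \<in> F"
  by (auto simp: F_def K_intros \<sigma>_simps tr_def nrm_def \<sigma>3)

lemmas F_intros = F_add F_mult F_uminus F_diff F_divide tr_F nrm_F

lemma adj_K: "x \<in> K \<Longrightarrow> adj x \<in> K"
  by (simp add: adj_def K_intros)

lemma nrm_eq_0_iff [simp]: "nrm x = 0 \<longleftrightarrow> x = 0"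
  by (auto simp: nrm_def)

section \<open>Linear dependences between twisted cubes\<close>

definition dep :: "'i set \<Rightarrow> ('i \<Rightarrow> 'a) \<Rightarrow> ('i \<Rightarrow> 'a) \<Rightarrow> bool" where
  "dep I t s \<longleftrightarrow> (\<forall>i\<in>I. t i \<in> F \<and> s i \<in> K) \<and> (\<Sum>i\<in>I. t i) = 0 \<and> (\<Sum>i\<in>I. t i * s i) = 0 \<and>
     (\<Sum>i\<in>I. t i * adj (s i)) = 0 \<and> (\<Sum>i\<in>I. t i * nrm (s i)) = 0"

text \<open>The coefficients lie in \<open>F\<close>, so \<open>\<sigma>\<close> can be applied to a
  relation without changing them. Together with the relations in \<open>dep\<close>, this covers all
  eight coordinates of the twisted cube.\<close>

lemma dep_conj:
  assumes "dep I t s"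
  shows "(\<Sum>i\<in>I. t i * \<sigma> (s i)) = 0" "(\<Sum>i\<in>I. t i * \<sigma> (\<sigma> (s i))) = 0"
    "(\<Sum>i\<in>I. t i * (\<sigma> (s i) * \<sigma> (\<sigma> (s i)))) = 0"
    "(\<Sum>i\<in>I. t i * (s i * \<sigma> (\<sigma> (s i)))) = 0"
    "(\<Sum>i\<in>I. t i * (s i * \<sigma> (s i))) = 0"
proof -
  have F: "\<And>i. i \<in> I \<Longrightarrow> \<sigma> (t i) = t i" "\<And>i. i \<in> I \<Longrightarrow> \<sigma> (\<sigma> (\<sigma> (s i))) = s i"
    using assms by (auto simp: dep_def F_\<sigma> \<sigma>3)
  have *: "(\<Sum>i\<in>I. t i * \<sigma> (f i)) = 0" if "(\<Sum>i\<in>I. t i * f i) = 0" for f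
  proof -
    have "(\<Sum>i\<in>I. t i * \<sigma> (f i)) = \<sigma> (\<Sum>i\<in>I. t i * f i)"
      unfolding \<sigma>_sum by (intro sum.cong) (auto simp: \<sigma>_mult F)
    then show ?thesis using that by simp
  qed
  show 1: "(\<Sum>i\<in>I. t i * \<sigma> (s i)) = 0" using assms by (intro *) (auto simp: dep_def)
  show "(\<Sum>i\<in>I. t i * \<sigma> (\<sigma> (s i))) = 0" by (intro * 1)
  show 2: "(\<Sum>i\<in>I. t i * (\<sigma> (s i) * \<sigma> (\<sigma> (s i)))) = 0" using assms by (auto simp: dep_def adj_def)
  have "(\<Sum>i\<in>I. t i * (s i * \<sigma> (\<sigma> (s i)))) = (\<Sum>i\<in>I. t i * \<sigma> (\<sigma> (s i) * \<sigma> (\<sigma> (s i))))"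
    by (intro sum.cong) (auto simp: \<sigma>_mult F)
  then show 3: "(\<Sum>i\<in>I. t i * (s i * \<sigma> (\<sigma> (s i)))) = 0" using *[OF 2] by simp
  have "(\<Sum>i\<in>I. t i * (s i * \<sigma> (s i))) = (\<Sum>i\<in>I. t i * \<sigma> (s i * \<sigma> (\<sigma> (s i))))"
    by (intro sum.cong) (auto simp: \<sigma>_mult F)
  then show "(\<Sum>i\<in>I. t i * (s i * \<sigma> (s i))) = 0" using *[OF 3] by simp
qed

text \<open>Expanding the product leaves a combination of the eight coordinate sums, all of which
  vanish.\<close>

lemma dep_contract:
  assumes "dep I t s"
  shows "(\<Sum>i\<in>I. t i * ((s i - a) * \<sigma> (s i - b) * \<sigma> (\<sigma> (s i - c)))) = 0"
proof -
  let ?b = "\<sigma> b" and ?c = "\<sigma> (\<sigma> c)"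
  have "t i * ((s i - a) * \<sigma> (s i - b) * \<sigma> (\<sigma> (s i - c))) =
     t i * nrm (s i) - a * (t i * (\<sigma> (s i) * \<sigma> (\<sigma> (s i)))) - ?b * (t i * (s i * \<sigma> (\<sigma> (s i))))
     - ?c * (t i * (s i * \<sigma> (s i))) + a * ?b * (t i * \<sigma> (\<sigma> (s i))) + a * ?c * (t i * \<sigma> (s i))
     + ?b * ?c * (t i * s i) - a * ?b * ?c * t i" for i
    by (simp add: nrm_def \<sigma>_diff algebra_simps)
  then show ?thesis
    using assms dep_conj[OF assms]
    by (simp add: sum.distrib sum_subtractf dep_def flip: sum_distrib_left)
qed

text \<open>The vectors \<open>(1, s, adj s, nrm s)\<close> are twisted tensor cubes of \<open>(1, s)\<close>, so any four of
  them are independent: contract the three factors with functionals vanishing at \<open>a\<close>, \<open>b\<close>, \<open>c\<close>.\<close>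
lemma dep_isolated:
  assumes "dep I t s" "finite I" "i \<in> I" "t i \<noteq> 0"
    and "\<And>j. j \<in> I \<Longrightarrow> j \<noteq> i \<Longrightarrow> t j = 0 \<or> s j \<in> {a, b, c}"
  shows "s i \<in> {a, b, c}"
proof -
  let ?f = "\<lambda>i. t i * ((s i - a) * \<sigma> (s i - b) * \<sigma> (\<sigma> (s i - c)))"
  have "0 = ?f i + (\<Sum>j\<in>I - {i}. ?f j)"
    using dep_contract[OF assms(1), of a b c] assms(2,3) by (simp add: sum.remove)
  also have "(\<Sum>j\<in>I - {i}. ?f j) = 0"
  proof (intro sum.neutral ballI)
    fix j assume "j \<in> I - {i}"
    with assms(5)[of j] show "?f j = 0" by auto
  qed
  finally show ?thesis using assms(4) by auto
qed

text \<open>The last coordinate of a product of the elements \<open>(t\<^sub>i (1, s\<^sub>i, adj s\<^sub>i, nrm s\<^sub>i), t\<^sub>i\<^sup>2 nrm s\<^sub>i)\<close>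
  of a Heisenberg group.\<close>
definition central :: "nat \<Rightarrow> (nat \<Rightarrow> 'a) \<Rightarrow> (nat \<Rightarrow> 'a) \<Rightarrow> 'a" where
  "central n t s = (\<Sum>i<n. t i ^ 2 * nrm (s i) + (\<Sum>j<i. t j * t i * (tr (adj (s j) * s i) - nrm (s j))))"

text \<open>Brings a product of two sums into the ordered shape of \<open>central\<close>; a
  correction of this shape vanishes as soon as one of the two sums does.\<close>

lemma mult_sums_ordered:
  fixes t f g :: "nat \<Rightarrow> 'a"
  shows "(\<Sum>i<n. t i * f i) * (\<Sum>i<n. t i * g i) =
     (\<Sum>i<n. t i ^ 2 * (f i * g i) + (\<Sum>j<i. t j * t i * (f j * g i + g j * f i)))"
proof (induction n)
  case (Suc n)
  have "(\<Sum>j<n. t j * t n * (f j * g n + g j * f n)) =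
    (\<Sum>j<n. t j * f j) * (t n * g n) + (\<Sum>j<n. t j * g j) * (t n * f n)"
    unfolding sum_distrib_right sum.distrib[symmetric] by (intro sum.cong) (auto simp: algebra_simps)
  then show ?case using Suc by (simp add: algebra_simps power2_eq_square)
qed simp

text \<open>Expanding in \<open>c = - h\<close> and its conjugates gives seven correction terms,
  each a multiple of a product of two sums that are zero by dependence.\<close>

lemma central_shift:
  assumes "dep {..<n} t s" "h \<in> K"
  shows "central n t (\<lambda>i. s i - h) = central n t s"
proof -
  define c where "c = - h"
  have c: "c \<in> K" using assms by (simp add: c_def K_uminus)
  let ?S = "\<lambda>f g. \<Sum>i<n. t i ^ 2 * (f i * g i) + (\<Sum>j<i. t j * t i * (f j * g i + g j * f i))"
  let ?s1 = "\<lambda>i. \<sigma> (s i)" and ?s2 = "\<lambda>i. \<sigma> (\<sigma> (s i))" and ?o = "\<lambda>i::nat. 1::'a"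
  let ?c1 = "\<sigma> c" and ?c2 = "\<sigma> (\<sigma> c)"
  have s3: "\<sigma> (\<sigma> (\<sigma> (s i))) = s i" if "i < n" for i
    using assms that by (auto simp: dep_def \<sigma>3)
  have c3: "\<sigma> (\<sigma> (\<sigma> c)) = c" using c by (rule \<sigma>3)
  have "central n t (\<lambda>i. s i + c) = central n t s + c * ?S ?s1 ?s2 + ?c1 * ?S s ?s2 + ?c2 * ?S s ?s1
     + ?c1 * ?c2 * ?S s ?o + c * ?c2 * ?S ?s1 ?o + c * ?c1 * ?S ?s2 ?o + c * ?c1 * ?c2 * ?S ?o ?o"
    unfolding central_def sum_distrib_left sum.distrib[symmetric]
  proof (intro sum.cong refl, goal_cases)
    case (1 i)
    let ?R = "\<lambda>f g j. t j * t i * (f j * g i + g j * f i)"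
    have "(\<Sum>j<i. t j * t i * (tr (adj (s j + c) * (s i + c)) - nrm (s j + c))) =
      (\<Sum>j<i. t j * t i * (tr (adj (s j) * s i) - nrm (s j)) + c * ?R ?s1 ?s2 j + ?c1 * ?R s ?s2 j + ?c2 * ?R s ?s1 j
     + ?c1 * ?c2 * ?R s ?o j + c * ?c2 * ?R ?s1 ?o j + c * ?c1 * ?R ?s2 ?o j + c * ?c1 * ?c2 * ?R ?o ?o j)"
    proof (intro sum.cong refl, goal_cases)
      case (1 j)
      then show ?case using \<open>i \<in> {..<n}\<close>
        by (simp add: tr_def adj_def nrm_def \<sigma>_add \<sigma>_mult s3 c3) (simp add: algebra_simps)
    qed
    then show ?case
      by (simp add: sum.distrib sum_distrib_left nrm_def \<sigma>_add) (simp add: algebra_simps sum.distrib sum_distrib_left)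
  qed
  also have "\<dots> = central n t s"
    using assms dep_conj[OF assms(1)] unfolding mult_sums_ordered[symmetric] by (simp add: dep_def)
  finally show ?thesis by (simp add: c_def)
qed

section \<open>Nonvanishing of the central coordinate for five distinct slopes\<close>

lemma F_closed_ratio:
  assumes n: "n1 \<in> F" "n2 \<in> F" "n3 \<in> F" "n1 \<noteq> 0" "n2 \<noteq> 0" "n3 \<noteq> 0"
    and lm: "l \<in> K" "m \<in> K"
    and 1: "n1 + n2 * l + n3 * m = 0" and 2: "n1 + n2 * adj l + n3 * adj m = 0"
  shows "l \<in> F"
proof -
  note s = F_\<sigma>[OF n(1)] F_\<sigma>[OF n(2)] F_\<sigma>[OF n(3)]
  let ?l1 = "\<sigma> l" and ?l2 = "\<sigma> (\<sigma> l)" and ?m1 = "\<sigma> m" and ?m2 = "\<sigma> (\<sigma> m)"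
  have 3: "n1 + n2 * ?l1 + n3 * ?m1 = 0" using arg_cong[OF 1, of \<sigma>] by (simp add: \<sigma>_simps s)
  have 4: "n1 + n2 * ?l2 + n3 * ?m2 = 0" using arg_cong[OF 3, of \<sigma>] by (simp add: \<sigma>_simps s)
  \<comment> \<open>The conjugates of the first relation express \<open>\<sigma> m\<close> and
    \<open>\<sigma> (\<sigma> m)\<close> linearly; inserting their product into the second relation
    eliminates \<open>m\<close>.\<close>
  have 5: "n1 * n3 + n1 ^ 2 + n1 * n2 * (?l1 + ?l2) + n2 * (n2 + n3) * (?l1 * ?l2) = 0"
  proof -
    have "(n3 * ?m1) * (n3 * ?m2) = (n1 + n2 * ?l1) * (n1 + n2 * ?l2)" using 3 4 by Groebner_Basis.algebra
    moreover have "n3 * (n1 + n2 * (?l1 * ?l2) + n3 * (?m1 * ?m2)) = 0" using 2 by (simp add: adj_def)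
    ultimately show ?thesis by (simp add: algebra_simps power2_eq_square)
  qed
  have 6: "n1 * n3 + n1 ^ 2 + n1 * n2 * (?l2 + l) + n2 * (n2 + n3) * (?l2 * l) = 0"
    using arg_cong[OF 5, of \<sigma>] lm by (simp add: \<sigma>_simps s \<sigma>3 power2_eq_square)
  have "(l - ?l1) * (n2 * (n1 + (n2 + n3) * ?l2)) = 0" using 5 6 by Groebner_Basis.algebra
  then consider "l = ?l1" | "n1 + (n2 + n3) * ?l2 = 0" using n(5) by auto
  then show ?thesis
  proof cases
    case 1
    then show ?thesis using lm by (simp add: F_def)
  next
    case 2
    with n(4) have 0: "n2 + n3 \<noteq> 0" by auto
    have "?l2 = - n1 / (n2 + n3)" using 2 0 by (simp add: field_simps eq_neg_iff_add_eq_0)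
    then have "?l2 \<in> F" using n by (simp add: F_intros)
    then have "\<sigma> ?l2 = ?l2" by (rule F_\<sigma>)
    then have "l = ?l2" using \<sigma>3[OF lm(1)] by simp
    then show ?thesis using \<open>?l2 \<in> F\<close> by simp
  qed
qed

text \<open>The left-hand side is the coefficient of \<open>nrm e\<close> in the central coordinate below, with
  \<open>1\<close>, \<open>l\<close>, \<open>m\<close>, \<open>0\<close> the positions of four of the slopes on a line over \<open>F\<close>.\<close>
lemma collinear_form_identity:
  fixes l m :: 'a
  assumes "n1 + n2 * l + n3 * m = 0" "n1 + n2 * l ^ 2 + n3 * m ^ 2 = 0"
    and "n2 = c * (m * (m - 1))" "m \<noteq> 0" "m \<noteq> 1"
  shows "n1^2 + n2^2 * l^3 + n3^2 * m^3 + n1 * n2 * (3 * l^2 - l^3) + n1 * n3 * (3 * m^2 - m^3) +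
     n2 * n3 * (3 * l * m^2 - m^3) = c^2 * (l * m^2 * (l - m)^2 * (1 - l)^2 * (1 - m))"
proof -
  \<comment> \<open>Subtracting the relations makes \<open>(n2, n3)\<close> proportional to
    \<open>(m * (m - 1), - (l * (l - 1)))\<close>, with factor \<open>c\<close>.\<close>
  have "n2 * (l * (l - 1)) + n3 * (m * (m - 1)) = 0" using assms(1,2) by Groebner_Basis.algebra
  then have "(m * (m - 1)) * (n3 + c * (l * (l - 1))) = 0" unfolding assms(3) by Groebner_Basis.algebra
  then have n3: "n3 = - (c * (l * (l - 1)))" using assms(4,5) by (simp add: eq_neg_iff_add_eq_0)
  have n1: "n1 = - (n2 * l + n3 * m)" using assms(1) by Groebner_Basis.algebra
  show ?thesis unfolding n1 n3 assms(3) by Groebner_Basis.algebra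
qed

text \<open>Inverting and translating moves two of the slopes to infinity and 0; dependence of the five
  vectors then forces the other three to be proportional over the fixed field.\<close>
lemma central_pentagon_origin:
  assumes dep: "dep {..<5} t s" and t: "\<And>i. i < 5 \<Longrightarrow> t i \<noteq> 0"
    and inj: "inj_on s {..<5}" and s4: "s 4 = 0"
  shows "central 5 t s \<noteq> 0"
proof -
  \<comment> \<open>Inversion sends the slope \<open>s 4 = 0\<close> to infinity. With the weights
    \<open>n\<close> it reverses the four coordinates, exchanging \<open>1\<close> with
    \<open>nrm\<close> and \<open>s\<close> with \<open>adj\<close>.\<close>
  define r where "r i = inverse (s i)" for i
  define n where "n i = t i * nrm (s i)" for i
  have L5: "{..<5::nat} = {0,1,2,3,4}" by auto
  have s0: "s i \<noteq> 0" if "i < 4" for i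
    using inj_onD[OF inj, of i 4] s4 that by auto
  have sK: "s i \<in> K" "t i \<in> F" if "i < 4" for i
    using dep that by (auto simp: dep_def)
  have r0: "r i \<noteq> 0" and rK: "r i \<in> K" and nF: "n i \<in> F" and n0: "n i \<noteq> 0" if "i < 4" for i
    using that s0[OF that] sK[OF that] t[of i] by (auto simp: r_def n_def K_intros F_intros)
  have sr: "s i = inverse (r i)" "t i = n i * nrm (r i)" if "i < 4" for i
    using s0[OF that] by (simp_all add: r_def n_def nrm_def \<sigma>_simps field_simps)
  have D: "t 0 * s 0 + t 1 * s 1 + t 2 * s 2 + t 3 * s 3 = 0"
    "t 0 * adj (s 0) + t 1 * adj (s 1) + t 2 * adj (s 2) + t 3 * adj (s 3) = 0"
    "t 0 * nrm (s 0) + t 1 * nrm (s 1) + t 2 * nrm (s 2) + t 3 * nrm (s 3) = 0"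
    using dep by (simp_all add: dep_def L5 s4 adj_def nrm_def algebra_simps)
  have ts: "t i * s i = n i * adj (r i)" "t i * adj (s i) = n i * r i" if "i < 4" for i
    using r0[OF that] by (simp_all add: sr[OF that] adj_def nrm_def \<sigma>_simps field_simps)
  have D1: "n 0 + n 1 + n 2 + n 3 = 0" using D(3) by (simp add: n_def)
  have D2: "n 0 * r 0 + n 1 * r 1 + n 2 * r 2 + n 3 * r 3 = 0" using D(2) by (simp add: ts)
  have D3: "n 0 * adj (r 0) + n 1 * adj (r 1) + n 2 * adj (r 2) + n 3 * adj (r 3) = 0"
    using D(1) by (simp add: ts)
  have fix_n: "\<sigma> (n i) = n i" if "i < 4" for i using nF[OF that] by (rule F_\<sigma>)
  \<comment> \<open>The affine map taking \<open>r 3\<close> to 0 and \<open>r 0\<close> to 1 takes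
    \<open>r 1\<close> and \<open>r 2\<close> to \<open>l\<close> and \<open>m\<close>.\<close>
  define a where "a = r 3"
  define e where "e = r 0 - r 3"
  define l where "l = (r 1 - r 3) / e"
  define m where "m = (r 2 - r 3) / e"
  have rinj: "r i \<noteq> r j" if "i < 4" "j < 4" "i \<noteq> j" for i j
    using inj_onD[OF inj, of i j] that s0 by (auto simp: r_def)
  have e0: "e \<noteq> 0" using rinj[of 0 3] by (simp add: e_def)
  have aK: "a \<in> K" and eK: "e \<in> K" and lK: "l \<in> K" and mK: "m \<in> K"
    by (auto simp: a_def e_def l_def m_def rK K_intros)
  have R: "r 0 = a + e" "r 1 = a + l * e" "r 2 = a + m * e" "r 3 = a"
    using e0 by (auto simp: a_def e_def l_def m_def)
  have lm: "l \<noteq> 0" "l \<noteq> 1" "m \<noteq> 0" "m \<noteq> 1" "l \<noteq> m"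
    using rinj[of 1 3] rinj[of 1 0] rinj[of 2 3] rinj[of 2 0] rinj[of 1 2] R by auto
  have E2: "n 0 + n 1 * l + n 2 * m = 0"
  proof -
    have "e * (n 0 + n 1 * l + n 2 * m) = 0" using D1 D2 unfolding R by Groebner_Basis.algebra
    then show ?thesis using e0 by simp
  qed
  have E3: "n 0 + n 1 * adj l + n 2 * adj m = 0"
  proof -
    have E21: "n 0 + n 1 * \<sigma> l + n 2 * \<sigma> m = 0"
      using arg_cong[OF E2, of \<sigma>] by (simp add: \<sigma>_simps fix_n)
    have E22: "n 0 + n 1 * \<sigma> (\<sigma> l) + n 2 * \<sigma> (\<sigma> m) = 0"
      using arg_cong[OF E21, of \<sigma>] by (simp add: \<sigma>_simps fix_n)
    have "adj e * (n 0 + n 1 * adj l + n 2 * adj m) = 0"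
      using D1 D3 E21 E22 unfolding R adj_def \<sigma>_add \<sigma>_mult by Groebner_Basis.algebra
    then show ?thesis using e0 by (simp add: adj_def)
  qed
  \<comment> \<open>With the next claim, the four inverted slopes lie on one \<open>F\<close>-line
    through \<open>a\<close> in direction \<open>e\<close>.\<close>
  have lF: "l \<in> F"
    by (rule F_closed_ratio[OF nF nF nF n0 n0 n0 lK mK E2 E3]) auto
  have mF: "m \<in> F"
  proof (rule F_closed_ratio[OF nF[of 0] nF[of 2] nF[of 1] n0 n0 n0 mK lK])
    show "n 0 + n 2 * m + n 1 * l = 0" "n 0 + n 2 * adj m + n 1 * adj l = 0"
      using E2 E3 by (simp_all add: ac_simps)
  qed auto
  have E3': "n 0 + n 1 * l ^ 2 + n 2 * m ^ 2 = 0"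
    using E3 by (simp add: adj_def F_\<sigma>[OF lF] F_\<sigma>[OF mF] power2_eq_square)
  \<comment> \<open>Inversion moves the adjoint from the earlier slope to the later one.\<close>
  have b: "t j * t i * (tr (adj (s j) * s i) - nrm (s j)) = n j * n i * (tr (r j * adj (r i)) - nrm (r i))"
    if "i < 4" "j < 4" for i j
  proof -
    have *: "\<sigma> (\<sigma> (\<sigma> (r i))) = r i" "\<sigma> (\<sigma> (\<sigma> (r j))) = r j"
      using rK that \<sigma>3 by auto
    show ?thesis
      using r0 that by (simp add: sr tr_def adj_def nrm_def \<sigma>_simps *) (simp add: field_simps)
  qed
  have d: "t i ^ 2 * nrm (s i) = n i ^ 2 * nrm (r i)" if "i < 4" for i
    using r0 that by (simp add: sr nrm_def \<sigma>_simps power2_eq_square field_simps)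
  have "central 5 t s =
     n 0^2 * nrm (r 0) + n 1^2 * nrm (r 1) + n 2^2 * nrm (r 2) + n 3^2 * nrm (r 3)
     + n 0 * n 1 * (tr (r 0 * adj (r 1)) - nrm (r 1)) + n 0 * n 2 * (tr (r 0 * adj (r 2)) - nrm (r 2))
     + n 0 * n 3 * (tr (r 0 * adj (r 3)) - nrm (r 3)) + n 1 * n 2 * (tr (r 1 * adj (r 2)) - nrm (r 2))
     + n 1 * n 3 * (tr (r 1 * adj (r 3)) - nrm (r 3)) + n 2 * n 3 * (tr (r 2 * adj (r 3)) - nrm (r 3))"
  proof -
    \<comment> \<open>Since \<open>s 4 = 0\<close>, the terms with \<open>t 4\<close> sum to a
      multiple of the vanishing norm relation.\<close>
    have "central 5 t s = (\<Sum>i<4. t i ^ 2 * nrm (s i) + (\<Sum>j<i. t j * t i * (tr (adj (s j) * s i) - nrm (s j))))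
        - t 4 * (t 0 * nrm (s 0) + t 1 * nrm (s 1) + t 2 * nrm (s 2) + t 3 * nrm (s 3))"
    proof -
      have "central 5 t s = (\<Sum>i<4. t i ^ 2 * nrm (s i) + (\<Sum>j<i. t j * t i * (tr (adj (s j) * s i) - nrm (s j))))
        + (t 4 ^ 2 * nrm (s 4) + (\<Sum>j<4. t j * t 4 * (tr (adj (s j) * s 4) - nrm (s j))))"
        unfolding central_def using sum.lessThan_Suc[of _ 4] by simp
      also have "t 4 ^ 2 * nrm (s 4) + (\<Sum>j<4. t j * t 4 * (tr (adj (s j) * s 4) - nrm (s j))) =
        - t 4 * (\<Sum>j<4. t j * nrm (s j))"
        unfolding s4 sum_distrib_left by (simp add: tr_def nrm_def sum_negf[symmetric] mult_ac)
      also have "(\<Sum>j<4. t j * nrm (s j)) = t 0 * nrm (s 0) + t 1 * nrm (s 1) + t 2 * nrm (s 2) + t 3 * nrm (s 3)"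
        by (simp add: eval_nat_numeral)
      finally show ?thesis by simp
    qed
    also have "\<dots> = (\<Sum>i<4. n i ^ 2 * nrm (r i) + (\<Sum>j<i. n j * n i * (tr (r j * adj (r i)) - nrm (r i))))"
    proof -
      have "t i ^ 2 * nrm (s i) + (\<Sum>j<i. t j * t i * (tr (adj (s j) * s i) - nrm (s j))) =
        n i ^ 2 * nrm (r i) + (\<Sum>j<i. n j * n i * (tr (r j * adj (r i)) - nrm (r i)))" if "i < 4" for i
        using that by (intro arg_cong2[where f = "(+)"] sum.cong d b) auto
      then show ?thesis using D(3) by simp
    qed
    finally show ?thesis by (simp add: eval_nat_numeral add_ac)
  qed
  \<comment> \<open>The base point \<open>a\<close> cancels by the dependence relations. As
    \<open>\<sigma>\<close> fixes \<open>l\<close> and \<open>m\<close>, the direction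
    \<open>e\<close> survives only through its norm.\<close>
  also have "\<dots> = nrm e * (n 0^2 + n 1^2 * l^3 + n 2^2 * m^3 + n 0 * n 1 * (3 * l^2 - l^3)
     + n 0 * n 2 * (3 * m^2 - m^3) + n 1 * n 2 * (3 * l * m^2 - m^3))"
  proof -
    have fl: "\<sigma> l = l" "\<sigma> m = m" using lF mF F_\<sigma> by auto
    have e3: "\<sigma> (\<sigma> (\<sigma> e)) = e" "\<sigma> (\<sigma> (\<sigma> a)) = a" using eK aK \<sigma>3 by auto
    have n3: "n 3 = - (n 0 + n 1 + n 2)" using D1 by Groebner_Basis.algebra
    show ?thesis using E2 E3' unfolding R tr_def adj_def nrm_def \<sigma>_add \<sigma>_mult fl e3 n3 by Groebner_Basis.algebra
  qed
  also have "\<dots> = nrm e * ((n 1 / (m * (m - 1)))^2 * (l * m^2 * (l - m)^2 * (1 - l)^2 * (1 - m)))"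
    using E2 E3' lm by (subst collinear_form_identity[where c = "n 1 / (m * (m - 1))"]) auto
  finally show ?thesis using e0 lm n0[of 1] by simp
qed

text \<open>Translation by \<open>s 4\<close> keeps the dependence and, by
  \<open>central_shift\<close>, the central coordinate, so one slope may be taken to be 0.\<close>

lemma central_pentagon:
  assumes dep: "dep {..<5} t s" and t: "\<And>i. i < 5 \<Longrightarrow> t i \<noteq> 0" and inj: "inj_on s {..<5}"
  shows "central 5 t s \<noteq> 0"
proof -
  let ?d = "\<lambda>i. s i - s 4"
  have K: "\<And>i. i < 5 \<Longrightarrow> t i \<in> F" "\<And>i. i < 5 \<Longrightarrow> s i \<in> K" using dep by (auto simp: dep_def)
  let ?h = "s 4"
  have adj: "t i * adj (?d i) = t i * adj (s i) - \<sigma> ?h * (t i * \<sigma> (\<sigma> (s i))) - \<sigma> (\<sigma> ?h) * (t i * \<sigma> (s i)) + adj ?h * t i" for i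
    by (simp add: adj_def \<sigma>_diff algebra_simps)
  have nrm: "nrm x = x * \<sigma> x * \<sigma> (\<sigma> x)" for x by (rule nrm_def)
  have "dep {..<5} t ?d"
    unfolding dep_def nrm adj
    using dep dep_conj[OF dep] dep_contract[OF dep, of ?h ?h ?h] K
    by (auto simp: dep_def K_intros right_diff_distrib sum_subtractf sum.distrib
        simp flip: sum_distrib_left sum_distrib_right)
  moreover have "inj_on ?d {..<5}" using inj by (auto simp: inj_on_def)
  ultimately have "central 5 t ?d \<noteq> 0" using t by (intro central_pentagon_origin) auto
  then show ?thesis using central_shift[OF dep, of ?h] K by simp
qed

subsection \<open>The affine part of the hexagon\<close>

definition points :: "('a \<times> 'a \<times> 'a \<times> 'a \<times> 'a) set" where
  "points = F \<times> K \<times> K \<times> F \<times> F"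

text \<open>A line is coded by its slope and the last four coordinates of its point with first
  coordinate 0.\<close>

definition lines :: "('a \<times> 'a \<times> 'a \<times> 'a \<times> 'a) set" where
  "lines = K \<times> K \<times> K \<times> F \<times> F"

text \<open>Points and lines of the twisted triality hexagon opposite a fixed flag, with points as elements
  of a Heisenberg group and lines as cosets of its one-parameter subgroups.\<close>
fun line :: "'a \<times> 'a \<times> 'a \<times> 'a \<times> 'a \<Rightarrow> 'a \<Rightarrow> 'a \<times> 'a \<times> 'a \<times> 'a \<times> 'a" where
  "line (s, y, z, u, c) t =
     (t, y + t * s, z + t * adj s, u + t * nrm s, c + t^2 * nrm s + t * tr (z * s) - t * u)"

lemma line_in_points: "l \<in> lines \<Longrightarrow> t \<in> F \<Longrightarrow> line l t \<in> points"
  by (cases l) (auto simp: lines_def points_def power2_eq_square adj_K F_K intro!: K_intros F_intros)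

lemma fst_line [simp]: "fst (line l t) = t"
  by (cases l) simp

lemma inj_line: "inj_on (line l) A"
  by (metis fst_line inj_onI)

lemma line_unique: "fst l = fst l' \<Longrightarrow> line l t = line l' t \<Longrightarrow> l = l'"
  by (cases l; cases l') auto

text \<open>A step is right multiplication in the Heisenberg group by the element of parameter
  \<open>t\<close> in the subgroup of slope \<open>s\<close>, so it has the same form from every
  base point.\<close>

lemma line_step:
  assumes "(x, y, z, u, c) \<in> line l ` F" "(x', y', z', u', c') \<in> line l ` F"
    and sK: "fst l \<in> K"
  defines "s \<equiv> fst l" and "t \<equiv> x' - x"
  shows "y' - y = t * s" "z' - z = t * adj s" "u' - u = t * nrm s"
    "c' - c = t^2 * nrm s + t * (tr (z * s) - u)"
proof -
  obtain s0 y0 z0 u0 c0 where l: "l = (s0, y0, z0, u0, c0)" by (cases l)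
  have F: "x \<in> F" "x' \<in> F" using assms(1,2) by (auto simp: l)
  have eqs: "s = s0" "y = y0 + x * s" "z = z0 + x * adj s" "u = u0 + x * nrm s"
    "c = c0 + x^2 * nrm s + x * tr (z0 * s) - x * u0"
    "y' = y0 + x' * s" "z' = z0 + x' * adj s" "u' = u0 + x' * nrm s"
    "c' = c0 + x'^2 * nrm s + x' * tr (z0 * s) - x' * u0"
    using assms(1,2) by (auto simp: l s_def)
  show "y' - y = t * s" "z' - z = t * adj s" "u' - u = t * nrm s"
    by (simp_all add: eqs(2-4,6-8) t_def algebra_simps)
  have "s \<in> K" using sK by (simp add: l eqs(1))
  then have "tr (x * nrm s) = x * nrm s + x * nrm s + x * nrm s"
    using F by (simp add: tr_def F_\<sigma> F_mult nrm_F)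
  moreover have "z * s = z0 * s + x * nrm s" by (simp add: eqs(3) adj_def nrm_def algebra_simps)
  then have "tr (z * s) = tr (z0 * s) + tr (x * nrm s)" by (simp add: tr_def \<sigma>_add)
  \<comment> \<open>The shift by \<open>3 * x * nrm s\<close> here and by \<open>x * nrm s\<close>
    in \<open>u\<close> differ by \<open>2 * x * nrm s\<close>, which turns \<open>t^2\<close> into
    \<open>x'^2 - x^2\<close>.\<close>
  ultimately have *: "tr (z * s) = tr (z0 * s) + (x * nrm s + x * nrm s + x * nrm s)" by simp
  show "c' - c = t^2 * nrm s + t * (tr (z * s) - u)"
    unfolding * eqs(4,5,9) t_def by (simp add: algebra_simps power2_eq_square)
qed

text \<open>Increments along a closed walk sum to 0: the first four coordinates yield the
  dependence, the last one the value of \<open>central\<close>.\<close>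

lemma closed_walk:
  assumes p: "\<And>i. i < n \<Longrightarrow> p i \<in> line (l i) ` F" "\<And>i. i < n \<Longrightarrow> p (Suc i) \<in> line (l i) ` F"
    and l: "\<And>i. i < n \<Longrightarrow> l i \<in> lines" and closed: "p n = p 0"
  defines "t \<equiv> \<lambda>i. fst (p (Suc i)) - fst (p i)" and "s \<equiv> \<lambda>i. fst (l i)"
  shows "dep {..<n} t s" "central n t s = 0"
proof -
  define y where "y i = fst (snd (p i))" for i
  define z where "z i = fst (snd (snd (p i)))" for i
  define u where "u i = fst (snd (snd (snd (p i))))" for i
  define c where "c i = snd (snd (snd (snd (p i))))" for i
  have pe: "p i = (fst (p i), y i, z i, u i, c i)" for i
    by (simp add: y_def z_def u_def c_def)
  have sK: "s i \<in> K" if "i < n" for i using l[OF that] by (cases "l i") (auto simp: s_def lines_def)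
  have tF: "t i \<in> F" if "i < n" for i using p[OF that] by (auto simp: t_def F_diff)
  have st: "y (Suc i) - y i = t i * s i" "z (Suc i) - z i = t i * adj (s i)"
    "u (Suc i) - u i = t i * nrm (s i)"
    "c (Suc i) - c i = t i ^ 2 * nrm (s i) + t i * (tr (z i * s i) - u i)" if "i < n" for i
  proof -
    have "(fst (p i), y i, z i, u i, c i) \<in> line (l i) ` F"
      "(fst (p (Suc i)), y (Suc i), z (Suc i), u (Suc i), c (Suc i)) \<in> line (l i) ` F" "fst (l i) \<in> K"
      using p[OF that] sK[OF that] by (simp_all only: pe[symmetric] s_def)
    from line_step[OF this] show "y (Suc i) - y i = t i * s i" "z (Suc i) - z i = t i * adj (s i)"
      "u (Suc i) - u i = t i * nrm (s i)"
      "c (Suc i) - c i = t i ^ 2 * nrm (s i) + t i * (tr (z i * s i) - u i)"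
      unfolding t_def s_def .
  qed
  have tele: "(\<Sum>i<n. f i) = 0" if "\<And>i. i < n \<Longrightarrow> g (Suc i) - g i = f i" "g n = g 0" for f g :: "nat \<Rightarrow> 'a"
  proof -
    have "(\<Sum>i<n. f i) = (\<Sum>i<n. g (Suc i) - g i)" using that(1) by (intro sum.cong) auto
    then show ?thesis using that(2) by (simp add: sum_lessThan_telescope)
  qed
  have cl: "y n = y 0" "z n = z 0" "u n = u 0" "c n = c 0"
    using closed by (simp_all add: y_def z_def u_def c_def)
  have S1: "(\<Sum>i<n. t i) = 0" by (rule tele[of "\<lambda>i. fst (p i)"]) (auto simp: t_def closed)
  show d: "dep {..<n} t s"
    unfolding dep_def using S1 tF sK tele[OF st(1) cl(1)] tele[OF st(2) cl(2)] tele[OF st(3) cl(3)]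
    by auto
  have zs: "z i = z 0 + (\<Sum>j<i. t j * adj (s j))" "u i = u 0 + (\<Sum>j<i. t j * nrm (s j))"
    if "i < n" for i
  proof -
    have "(\<Sum>j<i. t j * adj (s j)) = (\<Sum>j<i. z (Suc j) - z j)" using st(2) that by (intro sum.cong) auto
    then show "z i = z 0 + (\<Sum>j<i. t j * adj (s j))" by (simp add: sum_lessThan_telescope)
    have "(\<Sum>j<i. t j * nrm (s j)) = (\<Sum>j<i. u (Suc j) - u j)" using st(3) that by (intro sum.cong) auto
    then show "u i = u 0 + (\<Sum>j<i. t j * nrm (s j))" by (simp add: sum_lessThan_telescope)
  qed
  have "0 = (\<Sum>i<n. t i ^ 2 * nrm (s i) + t i * (tr (z i * s i) - u i))"
    using tele[OF st(4) cl(4)] by simp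
  also have "\<dots> = (\<Sum>i<n. (t i ^ 2 * nrm (s i) + (\<Sum>j<i. t j * t i * (tr (adj (s j) * s i) - nrm (s j))))
     + (z 0 * (t i * s i) + \<sigma> (z 0) * (t i * \<sigma> (s i)) + \<sigma> (\<sigma> (z 0)) * (t i * \<sigma> (\<sigma> (s i))) - u 0 * t i))"
  proof (intro sum.cong refl, goal_cases)
    case (1 i)
    have tt: "\<sigma> (t j) = t j" if "j < i" for j using tF[of j] F_\<sigma> 1 that by auto
    have *: "t i * tr ((\<Sum>j<i. t j * adj (s j)) * s i) = (\<Sum>j<i. t j * t i * tr (adj (s j) * s i))"
      unfolding tr_def sum_distrib_right \<sigma>_sum sum_distrib_left sum.distrib[symmetric]
      by (intro sum.cong) (auto simp: \<sigma>_mult tt algebra_simps)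
    have "t i * (tr (z i * s i) - u i) = t i * tr (z 0 * s i) + t i * tr ((\<Sum>j<i. t j * adj (s j)) * s i)
        - t i * u 0 - t i * (\<Sum>j<i. t j * nrm (s j))"
      using 1 by (simp add: zs[of i] tr_def \<sigma>_add \<sigma>_mult algebra_simps)
    also have "\<dots> = t i * tr (z 0 * s i) - t i * u 0 + (\<Sum>j<i. t j * t i * (tr (adj (s j) * s i) - nrm (s j)))"
      unfolding * by (simp add: sum_distrib_left right_diff_distrib sum_subtractf mult_ac)
    finally show ?case by (simp add: tr_def \<sigma>_mult algebra_simps)
  qed
  \<comment> \<open>The terms with the initial values \<open>z 0\<close> and \<open>u 0\<close> are
    linear in the steps and vanish by dependence.\<close>
  also have "\<dots> = central n t s"
    using d dep_conj[OF d]
    by (simp add: sum.distrib sum_subtractf central_def dep_def flip: sum_distrib_left)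
  finally show "central n t s = 0" ..
qed

section \<open>Exclusion of short polygons\<close>

definition joined where "joined l p q \<longleftrightarrow> l \<in> lines \<and> p \<in> line l ` F \<and> q \<in> line l ` F \<and> p \<noteq> q"

lemma joined_unique_slope:
  assumes "joined l p q" "joined l' q r" "fst l = fst l'"
  shows "l = l'"
proof -
  obtain t t' where "q = line l t" "q = line l' t'" using assms unfolding joined_def by auto
  moreover from this have "t = t'" by (metis fst_line)
  ultimately show ?thesis using line_unique assms(3) by metis
qed

text \<open>Neighbouring slopes differ. For 2 or 3 lines this contradicts independence; for 4 the
  slopes must alternate, for 5 they must be distinct, and then the central coordinate is
  nonzero.\<close>

lemma no_short_closed_walk:
  assumes j: "\<And>i. i < n \<Longrightarrow> joined (l i) (p i) (p (Suc i))" and closed: "p n = p 0" "l n = l 0"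
    and turn: "\<And>i. i < n \<Longrightarrow> l (Suc i) \<noteq> l i"
    and n: "n \<in> {2,3,4,5}"
  shows False
proof -
  have p: "p i \<in> line (l i) ` F" "p (Suc i) \<in> line (l i) ` F" and l: "l i \<in> lines"
    and step: "p (Suc i) \<noteq> p i" if "i < n" for i
    using j[OF that] by (auto simp: joined_def)
  define t where "t i = fst (p (Suc i)) - fst (p i)" for i
  define s where "s i = fst (l i)" for i
  have dep: "dep {..<n} t s" and central: "central n t s = 0"
    using closed_walk[OF p l closed(1)] by (simp_all add: t_def[abs_def] s_def[abs_def])
  have t0: "t i \<noteq> 0" if "i < n" for i
    using p[OF that] step[OF that] by (auto simp: t_def)
  have sn: "s n = s 0" using closed by (simp add: s_def)
  \<comment> \<open>Consecutive lines share a point, so equal slopes would make them equal; the last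
    index wraps around through \<open>l n = l 0\<close>.\<close>
  have st: "s (Suc i) \<noteq> s i" if "i < n" for i
  proof (cases "Suc i < n")
    case True
    then show ?thesis using turn[OF that] joined_unique_slope[OF j[OF that] j[OF True]] by (metis s_def)
  next
    case False
    then have *: "Suc i = n" "0 < n" using that by auto
    have "joined (l 0) (p (Suc i)) (p (Suc 0))" using j[OF *(2)] closed * by simp
    then show ?thesis using turn[OF that] joined_unique_slope[OF j[OF that]] closed * by (metis s_def)
  qed
  have st': "0 < n \<Longrightarrow> s 1 \<noteq> s 0" "1 < n \<Longrightarrow> s 2 \<noteq> s 1" "2 < n \<Longrightarrow> s 3 \<noteq> s 2" "3 < n \<Longrightarrow> s 4 \<noteq> s 3" "4 < n \<Longrightarrow> s 5 \<noteq> s 4"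
    using st[of 0] st[of 1] st[of 2] st[of 3] st[of 4] by (simp_all add: eval_nat_numeral)
  \<comment> \<open>The set \<open>A\<close> holds the indices whose slopes repeat one of the three
    named ones.\<close>
  have iso: "s i \<in> {s a, s b, s c}" if "i < n" "{..<n} \<subseteq> {i, a, b, c} \<union> A" "\<And>j. j \<in> A \<Longrightarrow> s j \<in> {s a, s b, s c}" for i a b c A
    by (rule dep_isolated[OF dep]) (use that t0 in auto)
  consider "n = 2" | "n = 3" | "n = 4" | "n = 5" using n by auto
  then show False
  proof cases
    case 1
    have "{..<n} \<subseteq> {0,1,1,1}" using 1 by auto
    then show False using 1 iso[of 0 1 1 1 "{}"] st'(1) by auto
  next
    case 2
    have "{..<n} \<subseteq> {0,1,2,2}" using 2 by auto
    then show False using 2 iso[of 0 1 2 2 "{}"] st'(1,3) sn by auto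
  next
    case 3
    have "{..<n} \<subseteq> {0,1,2,3}" "{..<n} \<subseteq> {1,2,3,0}" using 3 by auto
    then have "s 0 \<in> {s 1, s 2, s 3}" "s 1 \<in> {s 2, s 3, s 0}"
      using 3 by - (rule iso[of _ _ _ _ "{}"]; simp)+
    then have e: "s 0 = s 2" "s 1 = s 3" using st'(1-4) sn 3 by auto
    have S: "t 0 + t 1 + t 2 + t 3 = 0" "t 0 * s 0 + t 1 * s 1 + t 2 * s 0 + t 3 * s 1 = 0"
      using dep 3 e by (simp_all add: dep_def eval_nat_numeral)
    then have "(t 0 + t 2) * (s 0 - s 1) = 0" by Groebner_Basis.algebra
    then have t2: "t 2 = - t 0" using st'(1) 3 by (simp add: eq_neg_iff_add_eq_0 add.commute)
    with S(1) have t3: "t 3 = - t 1" by Groebner_Basis.algebra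
    have K: "\<sigma> (\<sigma> (\<sigma> (s 0))) = s 0" "\<sigma> (\<sigma> (\<sigma> (s 1))) = s 1" using dep 3 by (auto simp: dep_def \<sigma>3)
    have "central n t s = t 0 ^ 2 * nrm (s 0) + t 1 ^ 2 * nrm (s 1) + t 2 ^ 2 * nrm (s 0) + t 3 ^ 2 * nrm (s 1)
      + t 0 * t 1 * (tr (adj (s 0) * s 1) - nrm (s 0)) + t 0 * t 2 * (tr (adj (s 0) * s 0) - nrm (s 0))
      + t 0 * t 3 * (tr (adj (s 0) * s 1) - nrm (s 0)) + t 1 * t 2 * (tr (adj (s 1) * s 0) - nrm (s 1))
      + t 1 * t 3 * (tr (adj (s 1) * s 1) - nrm (s 1)) + t 2 * t 3 * (tr (adj (s 0) * s 1) - nrm (s 0))"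
      unfolding central_def 3 using e by (simp add: eval_nat_numeral add_ac)
    \<comment> \<open>The walk is now a commutator of two group elements, and this is its central
      part.\<close>
    also have "\<dots> = t 0 * t 1 * nrm (s 1 - s 0)"
      unfolding t2 t3 tr_def adj_def nrm_def \<sigma>_mult \<sigma>_diff K by Groebner_Basis.algebra
    finally show False using central t0[of 0] t0[of 1] st'(1) 3 by simp
  next
    case 4
    have L5: "{..<5::nat} = {0,1,2,3,4}" by auto
    \<comment> \<open>If two slopes at distance two agree, at most four values remain. Then
      \<open>s b\<close> must agree with \<open>s d\<close> or \<open>s e\<close>, and the slope
      left over is isolated. The five rotations cover all nonadjacent pairs.\<close>
    have neq: "s a \<noteq> s c" if "{..<5} = {a,b,c,d,e}" "s a \<noteq> s b" "s b \<noteq> s c" "s c \<noteq> s d" "s d \<noteq> s e" "s e \<noteq> s a" for a b c d e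
    proof
      assume ac: "s a = s c"
      have lt: "a < 5" "b < 5" "c < 5" "d < 5" "e < 5" using that(1) by auto
      have "s b \<in> {s a, s d, s e}"
        by (rule iso[of b a d e "{c}"]) (use that(1) 4 lt ac in auto)
      then have "s b = s d \<or> s b = s e" using that by auto
      then show False
      proof
        assume 1: "s b = s d"
        have "s e \<in> {s a, s d, s d}"
          by (rule iso[of e a d d "{b, c}"]) (use that(1) 4 lt ac 1 in auto)
        then show False using that by auto
      next
        assume 2: "s b = s e"
        have "s d \<in> {s a, s e, s e}"
          by (rule iso[of d a e e "{b, c}"]) (use that(1) 4 lt ac 2 in auto)
        then show False using that ac by auto
      qed
    qed
    have adjacent: "s 0 \<noteq> s 1" "s 1 \<noteq> s 2" "s 2 \<noteq> s 3" "s 3 \<noteq> s 4" "s 4 \<noteq> s 0"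
      using st' sn by (auto simp: 4)
    have n0: "s 0 \<noteq> s 2"
      by (rule neq[of 0 1 2 3 4]) (use adjacent in \<open>simp_all add: L5 insert_commute\<close>)
    have n1: "s 1 \<noteq> s 3"
      by (rule neq[of 1 2 3 4 0]) (use adjacent in \<open>simp_all add: L5 insert_commute\<close>)
    have n2: "s 2 \<noteq> s 4"
      by (rule neq[of 2 3 4 0 1]) (use adjacent in \<open>simp_all add: L5 insert_commute\<close>)
    have n3: "s 3 \<noteq> s 0"
      by (rule neq[of 3 4 0 1 2]) (use adjacent in \<open>simp_all add: L5 insert_commute\<close>)
    have n4: "s 4 \<noteq> s 1"
      by (rule neq[of 4 0 1 2 3]) (use adjacent in \<open>simp_all add: L5 insert_commute\<close>)
    have "inj_on s {..<5}"
      unfolding L5 using adjacent n0 n1 n2 n3 n4 by (simp add: inj_on_def)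
    then show False using central_pentagon[of t s] dep central t0 4 by simp
  qed
qed

lemma joined_trans: "joined l p q \<Longrightarrow> joined l q r \<Longrightarrow> p \<noteq> r \<Longrightarrow> joined l p r"
  by (auto simp: joined_def)

lemma joined_neq: "joined l p q \<Longrightarrow> p \<noteq> q"
  by (auto simp: joined_def)

lemma joined2:
  assumes j: "joined l0 p0 p1" "joined l1 p1 p0"
  shows "l0 = l1"
proof -
  have "l0 = l1"
  proof (rule ccontr)
    assume "\<not> ?thesis"
    with j show False
      \<comment> \<open>The lists repeat their first entry at the end to close the walk.\<close>
      by (intro no_short_closed_walk[where n = 2 and p = "(!) [p0, p1, p0]" and l = "(!) [l0, l1, l0]"])
        (auto simp: less_Suc_eq numeral_eq_Suc)
  qed
  then show ?thesis .
qed

text \<open>Some two consecutive lines coincide, and merging them leaves a shorter polygon. The same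
  reduction serves \<open>joined4\<close> and \<open>joined5\<close>, where distinct nonadjacent
  points keep the merged side proper.\<close>

lemma joined3:
  assumes j: "joined l0 p0 p1" "joined l1 p1 p2" "joined l2 p2 p0"
  shows "l0 = l1 \<and> l1 = l2"
proof -
  have "l0 = l1 \<or> l1 = l2 \<or> l2 = l0"
  proof (rule ccontr)
    assume "\<not> ?thesis"
    with j show False
      by (intro no_short_closed_walk[where n = 3 and p = "(!) [p0, p1, p2, p0]" and l = "(!) [l0, l1, l2, l0]"])
        (auto simp: less_Suc_eq numeral_eq_Suc)
  qed
  then show ?thesis
  proof (elim disjE)
    assume "l0 = l1"
    then have "joined l0 p0 p2"
      using joined_trans[of l0 p0 p1 p2] j(1,2) joined_neq[OF j(3)] by auto
    from joined2[OF this j(3)] show ?thesis using \<open>l0 = l1\<close> by auto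
  next
    assume "l1 = l2"
    then have "joined l1 p1 p0"
      using joined_trans[of l1 p1 p2 p0] j(2,3) joined_neq[OF j(1)] by auto
    from joined2[OF this j(1)] show ?thesis using \<open>l1 = l2\<close> by auto
  next
    assume "l2 = l0"
    then have "joined l2 p2 p1"
      using joined_trans[of l2 p2 p0 p1] j(3,1) joined_neq[OF j(2)] by auto
    from joined2[OF this j(2)] show ?thesis using \<open>l2 = l0\<close> by auto
  qed
qed

lemma joined4:
  assumes j: "joined l0 p0 p1" "joined l1 p1 p2" "joined l2 p2 p3" "joined l3 p3 p0"
    and ne: "p0 \<noteq> p2" "p1 \<noteq> p3"
  shows "l0 = l1 \<and> l1 = l2 \<and> l2 = l3"
proof -
  have "l0 = l1 \<or> l1 = l2 \<or> l2 = l3 \<or> l3 = l0"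
  proof (rule ccontr)
    assume "\<not> ?thesis"
    with j show False
      by (intro no_short_closed_walk[where n = 4 and p = "(!) [p0, p1, p2, p3, p0]" and l = "(!) [l0, l1, l2, l3, l0]"])
        (auto simp: less_Suc_eq numeral_eq_Suc)
  qed
  then show ?thesis
  proof (elim disjE)
    assume "l0 = l1"
    then have "joined l0 p0 p2"
      using joined_trans[of l0 p0 p1 p2] j(1,2) ne by auto
    from joined3[OF this j(3) j(4)] show ?thesis using \<open>l0 = l1\<close> by auto
  next
    assume "l1 = l2"
    then have "joined l1 p1 p3"
      using joined_trans[of l1 p1 p2 p3] j(2,3) ne by auto
    from joined3[OF this j(4) j(1)] show ?thesis using \<open>l1 = l2\<close> by auto
  next
    assume "l2 = l3"
    then have "joined l2 p2 p0"
      using joined_trans[of l2 p2 p3 p0] j(3,4) ne by auto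
    from joined3[OF this j(1) j(2)] show ?thesis using \<open>l2 = l3\<close> by auto
  next
    assume "l3 = l0"
    then have "joined l3 p3 p1"
      using joined_trans[of l3 p3 p0 p1] j(4,1) ne by auto
    from joined3[OF this j(2) j(3)] show ?thesis using \<open>l3 = l0\<close> by auto
  qed
qed

lemma joined5:
  assumes j: "joined l0 p0 p1" "joined l1 p1 p2" "joined l2 p2 p3" "joined l3 p3 p4" "joined l4 p4 p0"
    and ne: "p0 \<noteq> p2" "p1 \<noteq> p3" "p2 \<noteq> p4" "p3 \<noteq> p0" "p4 \<noteq> p1"
  shows "l0 = l1 \<and> l1 = l2 \<and> l2 = l3 \<and> l3 = l4"
proof -
  have "l0 = l1 \<or> l1 = l2 \<or> l2 = l3 \<or> l3 = l4 \<or> l4 = l0"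
  proof (rule ccontr)
    assume "\<not> ?thesis"
    with j show False
      by (intro no_short_closed_walk[where n = 5 and p = "(!) [p0, p1, p2, p3, p4, p0]" and l = "(!) [l0, l1, l2, l3, l4, l0]"])
        (auto simp: less_Suc_eq numeral_eq_Suc)
  qed
  then show ?thesis
  proof (elim disjE)
    assume "l0 = l1"
    then have "joined l0 p0 p2"
      using joined_trans[of l0 p0 p1 p2] j(1,2) ne by auto
    from joined4[OF this j(3) j(4) j(5)] show ?thesis using \<open>l0 = l1\<close> ne by auto
  next
    assume "l1 = l2"
    then have "joined l1 p1 p3"
      using joined_trans[of l1 p1 p2 p3] j(2,3) ne by auto
    from joined4[OF this j(4) j(5) j(1)] show ?thesis using \<open>l1 = l2\<close> ne by auto
  next
    assume "l2 = l3"
    then have "joined l2 p2 p4"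
      using joined_trans[of l2 p2 p3 p4] j(3,4) ne by auto
    from joined4[OF this j(5) j(1) j(2)] show ?thesis using \<open>l2 = l3\<close> ne by auto
  next
    assume "l3 = l4"
    then have "joined l3 p3 p0"
      using joined_trans[of l3 p3 p4 p0] j(4,5) ne by auto
    from joined4[OF this j(1) j(2) j(3)] show ?thesis using \<open>l3 = l4\<close> ne by auto
  next
    assume "l4 = l0"
    then have "joined l4 p4 p1"
      using joined_trans[of l4 p4 p0 p1] j(5,1) ne by auto
    from joined4[OF this j(2) j(3) j(4)] show ?thesis using \<open>l4 = l0\<close> ne by auto
  qed
qed

text \<open>Several edges may later be placed on the same line, so short cycles are not excluded
  here but confined to a single line.\<close>

lemma lines_cycle:
  fixes k :: nat
  assumes k: "2 \<le> k" "k \<le> 5" and inj: "inj_on v {..<k}"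
    and on: "\<And>i. i < k \<Longrightarrow> l i \<in> lines \<and> {v i, v ((i + 1) mod k)} \<subseteq> line (l i) ` F"
    and i: "i < k"
  shows "l i = l 0"
proof -
  have j: "joined (l i) (v i) (v ((i + 1) mod k))" if "i < k" for i
  proof -
    have "(i + 1) mod k \<noteq> i" using k(1) that by (cases "Suc i = k") auto
    then have "v i \<noteq> v ((i + 1) mod k)" using inj_onD[OF inj, of i "(i + 1) mod k"] that by auto
    then show ?thesis using on[OF that] by (simp add: joined_def)
  qed
  have ne: "v a \<noteq> v b" if "a < k" "b < k" "a \<noteq> b" for a b
    using inj_onD[OF inj] that by auto
  consider "k = 2" | "k = 3" | "k = 4" | "k = 5" using k by linarith
  then show ?thesis
  proof cases
    case 1
    have "l 0 = l 1" using j[of 0] j[of 1] 1 by (intro joined2[of _ "v 0" "v 1"]) auto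
    then show ?thesis using i 1 by (auto simp: less_2_cases_iff)
  next
    case 2
    have "l 0 = l 1 \<and> l 1 = l 2"
      using j[of 0] j[of 1] j[of 2] 2 by (intro joined3[of _ "v 0" "v 1" _ "v 2"]) (simp_all del: One_nat_def)
    moreover have "i = 0 \<or> i = 1 \<or> i = 2" using i 2 by linarith
    ultimately show ?thesis by auto
  next
    case 3
    have "l 0 = l 1 \<and> l 1 = l 2 \<and> l 2 = l 3"
      using j[of 0] j[of 1] j[of 2] j[of 3] 3
      by (intro joined4[of _ "v 0" "v 1" _ "v 2" _ "v 3"] ne) (simp_all del: One_nat_def)
    moreover have "i = 0 \<or> i = 1 \<or> i = 2 \<or> i = 3" using i 3 by linarith
    ultimately show ?thesis by auto
  next
    case 4
    have "l 0 = l 1 \<and> l 1 = l 2 \<and> l 2 = l 3 \<and> l 3 = l 4"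
      using j[of 0] j[of 1] j[of 2] j[of 3] j[of 4] 4
      by (intro joined5[of _ "v 0" "v 1" _ "v 2" _ "v 3" _ "v 4"] ne) (simp_all del: One_nat_def)
    moreover have "i = 0 \<or> i = 1 \<or> i = 2 \<or> i = 3 \<or> i = 4" using i 4 by linarith
    ultimately show ?thesis by auto
  qed
qed

section \<open>Replacing lines by copies of a hypergraph\<close>

definition blowup :: "'a set set \<Rightarrow> ('a \<times> 'a \<times> 'a \<times> 'a \<times> 'a) set set" where
  "blowup H = (\<lambda>(l, e). line l ` e) ` (lines \<times> H)"

text \<open>A short cycle stays on one line by \<open>lines_cycle\<close>; pulled back along the
  parametrization of that line, it is a cycle of \<open>H\<close>.\<close>

lemma girth_blowup:
  assumes H: "\<Union>H \<subseteq> F" "enat 6 \<le> girth H"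
  shows "enat 6 \<le> girth (blowup H)"
  unfolding girth_ge_iff
proof (intro allI impI notI)
  fix k :: nat assume k: "2 \<le> k \<and> k < 6" and "\<exists>v e. is_cycle (blowup H) k v e"
  then obtain v e where c: "is_cycle (blowup H) k v e" by blast
  have "\<exists>l d. l \<in> lines \<and> d \<in> H \<and> e i = line l ` d" if "i < k" for i
    using c that unfolding is_cycle_def blowup_def by fastforce
  then obtain l d where ld: "\<And>i. i < k \<Longrightarrow> l i \<in> lines \<and> d i \<in> H \<and> e i = line (l i) ` d i" by metis
  have "l i = l 0" if "i < k" for i
  proof (rule lines_cycle[OF _ _ _ _ that])
    show "inj_on v {..<k}" using c by (simp add: is_cycle_def)
    fix i assume i: "i < k"
    have "d i \<subseteq> F" using ld[OF i] H(1) by auto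
    moreover have "{v i, v ((i + 1) mod k)} \<subseteq> line (l i) ` d i"
      using c i ld[OF i] by (auto simp: is_cycle_def)
    ultimately show "l i \<in> lines \<and> {v i, v ((i + 1) mod k)} \<subseteq> line (l i) ` F"
      using ld[OF i] by blast
  qed (use k in auto)
  then have "is_cycle ((`) (line (l 0)) ` H) k v e"
    using c ld unfolding is_cycle_def by (metis imageI)
  then have "\<exists>v' e'. is_cycle H k v' e'" by (rule is_cycle_image) (rule inj_line)
  then show False using H(2) k unfolding girth_ge_iff by blast
qed

lemma blowup_subset: "\<Union>H \<subseteq> F \<Longrightarrow> \<Union>(blowup H) \<subseteq> points"
  using line_in_points by (fastforce simp: blowup_def)

lemma uniform_blowup: "uniform r H \<Longrightarrow> uniform r (blowup H)"
  by (auto simp: uniform_def blowup_def card_image inj_line)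

text \<open>As \<open>2 \<le> r\<close>, an edge has two points, and these determine its line by
  \<open>joined2\<close>.\<close>

lemma card_blowup:
  assumes H: "\<Union>H \<subseteq> F" "uniform r H" "2 \<le> r"
  shows "card (blowup H) = card lines * card H"
proof -
  have "inj_on (\<lambda>(l, e). line l ` e) (lines \<times> H)"
  proof (rule inj_onI)
    fix x x' assume x: "x \<in> lines \<times> H" "x' \<in> lines \<times> H"
      "(case x of (l, e) \<Rightarrow> line l ` e) = (case x' of (l, e) \<Rightarrow> line l ` e)"
    obtain l e l' e' where xs: "x = (l, e)" "x' = (l', e')" by (metis surj_pair)
    have 1: "l \<in> lines" "e \<in> H" "l' \<in> lines" "e' \<in> H" "line l ` e = line l' ` e'"
      using x by (simp_all add: xs)
    have "card e = r" using 1 H(2) by (auto simp: uniform_def)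
    then have "2 \<le> card e" using H(3) by simp
    then obtain T where "T \<subseteq> e" "card T = 2" by (rule obtain_subset_with_card_n)
    then obtain a b where ab: "a \<in> e" "b \<in> e" "a \<noteq> b" by (auto simp: card_2_iff)
    have sub: "line l ` e \<subseteq> line l ` F" "line l' ` e' \<subseteq> line l' ` F" using 1 H(1) by auto
    have "line l a \<in> line l ` e" "line l b \<in> line l ` e" using ab by auto
    moreover have "line l a \<noteq> line l b" using ab(3) by (metis fst_line)
    ultimately have "joined l (line l a) (line l b)" "joined l' (line l b) (line l a)"
      using 1 sub unfolding joined_def by auto
    then have "l = l'" by (rule joined2)
    then show "x = x'" using 1 inj_image_eq_iff[OF inj_line] xs by metis
  qed
  then show ?thesis unfolding blowup_def by (simp add: card_image card_cartesian_product)
qed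

lemma card_points: "card points = card F ^ 3 * card K ^ 2"
  by (simp add: points_def card_cartesian_product power2_eq_square power3_eq_cube)

lemma card_lines: "card lines = card K ^ 3 * card F ^ 2"
  by (simp add: lines_def card_cartesian_product power2_eq_square power3_eq_cube)

end

section \<open>Finite fields of characteristic two\<close>

text \<open>Over an algebraically closed field a root splits off; the derivative condition makes it
  simple and passes to the quotient.\<close>

lemma card_roots_separable:
  fixes p :: "'a::alg_closed_field poly"
  assumes "p \<noteq> 0" "\<And>x. poly p x = 0 \<Longrightarrow> poly (pderiv p) x \<noteq> 0"
  shows "card {x. poly p x = 0} = degree p"
  using assms
proof (induction "degree p" arbitrary: p)
  case 0
  then obtain c where "p = [:c:]" "c \<noteq> 0" by (metis degree_eq_zeroE pCons_0_0)
  then show ?case by simp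
next
  case (Suc n)
  then obtain a where a: "poly p a = 0" using alg_closed_imp_poly_has_root[of p] by auto
  then obtain r where p: "p = [:-a, 1:] * r" by (metis dvdE poly_eq_0_iff_dvd)
  have r: "r \<noteq> 0" using Suc.prems(1) p by auto
  have deg: "degree p = Suc (degree r)" unfolding p using r by (subst degree_mult_eq) auto
  have der: "poly (pderiv p) x = poly r x + (x - a) * poly (pderiv r) x" for x
    unfolding p pderiv_mult by (simp add: pderiv_pCons algebra_simps del: mult_pCons_left)
  have ra: "poly r a \<noteq> 0" using Suc.prems(2)[OF a] der[of a] by simp
  have "card {x. poly r x = 0} = degree r"
  proof (rule Suc.hyps(1))
    fix x assume x: "poly r x = 0"
    then have "poly p x = 0" by (simp add: p)
    then show "poly (pderiv r) x \<noteq> 0" using Suc.prems(2)[of x] der[of x] x by auto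
  qed (use Suc.hyps(2) deg r in auto)
  moreover have "{x. poly p x = 0} = insert a {x. poly r x = 0}" by (auto simp: p)
  moreover have "finite {x. poly r x = 0}" using r by (rule poly_roots_finite)
  ultimately show ?case using ra deg by simp
qed

text \<open>Contains the finite fields of all orders \<open>2 ^ m\<close> with \<open>m > 0\<close>
  as subsets of a single type.\<close>

type_synonym K2 = "bit alg_closure"

lemma K2_char2: "x + x = (0 :: K2)"
proof -
  have "(1 + 1 :: K2) = to_ac (1 + 1 :: bit)" by (simp only: to_ac_add to_ac_1)
  also have "(1 + 1 :: bit) = 0" by simp
  finally have "(1 + 1 :: K2) * x = 0" by simp
  then show ?thesis by (simp add: algebra_simps)
qed

lemma K2_two: "(2 :: K2) = 0"
  using K2_char2[of 1] by (simp only: one_add_one)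

lemma K2_power_add: "(x + y :: K2) ^ (2 ^ m) = x ^ (2 ^ m) + y ^ (2 ^ m)"
proof (induction m)
  case (Suc m)
  have "(x + y) ^ (2 ^ Suc m) = ((x + y) ^ (2 ^ m)) ^ 2" by (simp add: mult.commute flip: power_mult)
  also have "\<dots> = (x ^ (2 ^ m)) ^ 2 + (y ^ (2 ^ m)) ^ 2 + (x ^ 2 ^ m * y ^ 2 ^ m + x ^ 2 ^ m * y ^ 2 ^ m)"
    unfolding Suc by (simp add: power2_eq_square algebra_simps)
  also have "\<dots> = x ^ (2 ^ Suc m) + y ^ (2 ^ Suc m)"
    unfolding K2_char2 by (simp add: mult.commute flip: power_mult)
  finally show ?case .
qed simp

text \<open>In characteristic two the derivative of \<open>x ^ (2 ^ m) - x\<close> is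
  \<open>-1\<close>, so all roots are simple.\<close>

lemma card_K2_subfield:
  assumes "m > 0"
  shows "card {x :: K2. x ^ (2 ^ m) = x} = 2 ^ m"
proof -
  define p :: "K2 poly" where "p = monom 1 (2 ^ m) - monom 1 1"
  have "1 < (2 :: nat) ^ m" using assms one_less_power[of "2 :: nat" m] by simp
  then have deg: "degree p = 2 ^ m" unfolding p_def diff_conv_add_uminus
    by (subst degree_add_eq_left) (simp_all add: degree_monom_eq)
  then have "p \<noteq> 0" by auto
  have "of_nat (2 ^ m) = (0 :: K2)" using assms by (simp only: of_nat_power of_nat_numeral K2_two zero_power)
  then have "pderiv p = - 1"
    unfolding p_def pderiv_diff pderiv_monom by (simp only: mult_zero_left) simp
  then have "card {x. poly p x = 0} = degree p" using \<open>p \<noteq> 0\<close> by (intro card_roots_separable) auto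
  then show ?thesis by (simp add: deg) (simp add: p_def poly_monom)
qed

lemma K2_subfield_closed:
  fixes x y :: K2
  assumes "x ^ (2 ^ m) = x" "y ^ (2 ^ m) = y"
  shows "(x + y) ^ (2 ^ m) = x + y" "(x * y) ^ (2 ^ m) = x * y" "(- x) ^ (2 ^ m) = - x"
    "inverse x ^ (2 ^ m) = inverse x"
proof -
  have "- x = x" using K2_char2[of x] by (rule minus_unique)
  then show "(- x) ^ (2 ^ m) = - x" using assms(1) by (simp only:)
qed (use assms in \<open>simp_all add: K2_power_add power_mult_distrib power_inverse\<close>)

lemma cubic_extension_K2:
  "cubic_extension (\<lambda>x :: K2. x ^ (2 ^ m)) {x. x ^ (2 ^ (3 * m)) = x}"
proof
  fix x :: K2 assume "x \<in> {x. x ^ (2 ^ (3 * m)) = x}"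
  moreover have "((x ^ (2 ^ m)) ^ (2 ^ m)) ^ (2 ^ m) = x ^ (2 ^ (3 * m))"
    by (simp add: numeral_3_eq_3 power_add mult.assoc flip: power_mult)
  ultimately show "((x ^ (2 ^ m)) ^ (2 ^ m)) ^ (2 ^ m) = x" by simp
next
  fix x :: K2 assume "x \<in> {x. x ^ (2 ^ (3 * m)) = x}"
  then have "(x ^ (2 ^ (3 * m))) ^ 2 ^ m = x ^ 2 ^ m" by simp
  then have "(x ^ 2 ^ m) ^ (2 ^ (3 * m)) = x ^ 2 ^ m" by (simp only: power_mult[symmetric] mult.commute)
  then show "x ^ 2 ^ m \<in> {x. x ^ (2 ^ (3 * m)) = x}" by simp
qed (auto simp: K2_power_add power_mult_distrib K2_subfield_closed)

text \<open>Since \<open>F\<close> is cut out inside \<open>K\<close>, this is what identifies it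
  with all fixed points of the Frobenius power, which are counted above.\<close>

lemma K2_fixed_field:
  fixes x :: K2
  assumes "x ^ (2 ^ m) = x"
  shows "x ^ (2 ^ (3 * m)) = x"
proof -
  have "x ^ (2 ^ (3 * m)) = ((x ^ (2 ^ m)) ^ (2 ^ m)) ^ (2 ^ m)"
    by (simp add: numeral_3_eq_3 power_add mult.assoc flip: power_mult)
  then show ?thesis by (simp add: assms)
qed

section \<open>Growth of the extremal function\<close>

lemma ex_in_edge_counts: "ex r N g \<in> edge_counts r N g"
  unfolding ex_def by (intro Max_in finite_edge_counts edge_counts_nonempty)

text \<open>The vertices in \<open>ex\<close> are natural numbers; a bijection moves an extremal
  hypergraph to any finite set, here later to \<open>F\<close>.\<close>

lemma ex_attained:
  assumes "finite A"
  shows "\<exists>E. \<Union>E \<subseteq> A \<and> uniform r E \<and> enat g \<le> girth E \<and> card E = ex r (card A) g"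
proof -
  obtain V :: "nat set" and E where VE: "hypergraph V E" "card V = card A" "uniform r E"
    "enat g \<le> girth E" "card E = ex r (card A) g"
    using ex_in_edge_counts[of r "card A" g] unfolding edge_counts_def by (smt (verit) mem_Collect_eq)
  have "finite V" and sub: "\<Union>E \<subseteq> V" using VE(1) by (auto simp: hypergraph_def)
  then obtain f where f: "bij_betw f V A" using VE(2) assms finite_same_card_bij by blast
  then have inj: "inj_on f (\<Union>E)" using sub by (auto simp: bij_betw_def intro: inj_on_subset)
  let ?E = "(`) f ` E"
  have "\<Union>?E \<subseteq> A" using f sub by (auto simp: bij_betw_def)
  moreover have "uniform r ?E"
    using VE(3) inj by (rule uniform_image)
  moreover have "enat g \<le> girth ?E" using VE(4) inj by (rule girth_image_ge)
  moreover have "card ?E = card E"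
    using inj by (intro card_image inj_on_image)
  ultimately show ?thesis using VE(5) by metis
qed

text \<open>After an injection into \<open>{..<N}\<close> the remaining numbers are isolated
  vertices; \<open>r > 0\<close> makes the edges nonempty.\<close>

lemma card_le_ex:
  fixes E :: "'a set set"
  assumes "finite A" "\<Union>E \<subseteq> A" "uniform r E" "enat g \<le> girth E" "card A \<le> N" "r > 0"
  shows "card E \<le> ex r N g"
proof -
  obtain f where f: "inj_on f A" "f ` A \<subseteq> {..<N}"
    using card_le_inj[of A "{..<N}"] assms(1,5) by auto
  then have inj: "inj_on f (\<Union>E)" using assms(2) by (auto intro: inj_on_subset)
  let ?E = "(`) f ` E"
  have 1: "uniform r ?E"
    using assms(3) inj by (rule uniform_image)
  have "d \<subseteq> {..<N}" if "d \<in> ?E" for d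
    using that f(2) assms(2) by auto
  moreover have "d \<noteq> {}" if "d \<in> ?E" for d
    using that 1 \<open>r > 0\<close> unfolding uniform_def by (metis card.empty less_irrefl)
  ultimately have "hypergraph {..<N} ?E" unfolding hypergraph_def by blast
  moreover have "enat g \<le> girth ?E" using assms(4) inj by (rule girth_image_ge)
  ultimately have "card ?E \<in> edge_counts r N g" using 1 card_lessThan[of N] unfolding edge_counts_def by blast
  then have "card ?E \<le> ex r N g" unfolding ex_def by (intro Max_ge finite_edge_counts)
  moreover have "card ?E = card E" using inj by (intro card_image inj_on_image)
  ultimately show ?thesis by simp
qed

lemma ex_mono:
  assumes "M \<le> N" "r > 0"
  shows "ex r M g \<le> ex r N g"
proof -
  obtain E :: "nat set set" where "\<Union>E \<subseteq> {..<M}" "uniform r E" "enat g \<le> girth E" "card E = ex r M g"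
    using ex_attained[of "{..<M}" r g] by auto
  then show ?thesis using card_le_ex[of "{..<M}" E r g N] assms by simp
qed

lemma ex_pos:
  assumes "r \<le> N" "r > 0"
  shows "ex r N g \<ge> 1"
proof -
  have "\<not> is_cycle {{..<r}} k v e" for k v e
  proof
    assume c: "is_cycle {{..<r}} k v e"
    then have k: "0 < k" "1 < k" and e: "\<forall>i<k. e i \<in> {{..<r}}" and inj: "inj_on e {..<k}"
      unfolding is_cycle_def by (linarith, linarith, blast, blast)
    have "e 0 = e 1" using e k by (metis singletonD)
    then show False using inj_onD[OF inj, of 0 1] k by simp
  qed
  then have "enat g \<le> girth {{..<r}}" by (simp add: girth_ge_iff)
  then show ?thesis
    using card_le_ex[of "{..<r}" "{{..<r}}" r g N] assms by (simp add: uniform_def)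
qed

lemma ex_ninth_power:
  assumes "m > 0" "r \<ge> 2"
  shows "ex r ((2 ^ m) ^ 9) 6 \<ge> (2 ^ m) ^ 11 * ex r (2 ^ m) 6"
proof -
  define q :: nat where "q = 2 ^ m"
  interpret cubic_extension "\<lambda>x :: K2. x ^ (2 ^ m)" "{x :: K2. x ^ (2 ^ (3 * m)) = x}"
    by (rule cubic_extension_K2)
  have F: "F = {x. x ^ (2 ^ m) = x}" unfolding F_def using K2_fixed_field by auto
  have cF: "card F = q" unfolding F q_def using assms(1) by (rule card_K2_subfield)
  have cK: "card {x :: K2. x ^ (2 ^ (3 * m)) = x} = q ^ 3"
    unfolding q_def power_mult[symmetric] mult.commute[of m]
    using assms(1) by (intro card_K2_subfield) simp
  have "finite F" using cF by (intro card_ge_0_finite) (simp add: q_def)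
  then obtain H where H: "\<Union>H \<subseteq> F" "uniform r H" "enat 6 \<le> girth H" "card H = ex r q 6"
    using ex_attained[of F r 6] cF by auto
  have cP: "card points = q ^ 9" unfolding card_points cF cK by (simp flip: power_mult power_add)
  have cL: "card lines = q ^ 11" unfolding card_lines cF cK by (simp flip: power_mult power_add)
  have "finite points" using cP by (intro card_ge_0_finite) (simp add: q_def)
  then have "card (blowup H) \<le> ex r (q ^ 9) 6"
    using blowup_subset[OF H(1)] uniform_blowup[OF H(2)] girth_blowup[OF H(1,3)] cP assms(2)
    by (intro card_le_ex[of points]) auto
  then show ?thesis using card_blowup[OF H(1,2) assms(2)] cL H(4) by (simp add: q_def)
qed

text \<open>Passing from \<open>n\<close> to \<open>n div 9\<close> loses a bounded factor, so the total loss is \<open>2 powr O(ln n)\<close>;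
  the square root is just a convenient upper bound for the number of steps.\<close>
lemma ex_power2_lower_bound:
  assumes "r \<ge> 2"
  shows "\<exists>A. \<forall>n. n \<ge> r \<longrightarrow> real (ex r (2 ^ n) 6) \<ge> 2 powr (11 / 8 * n - 17 * sqrt n - A)"
proof -
  \<comment> \<open>Makes the exponent nonpositive for \<open>n < 9 * r + 9\<close>, where one edge
    suffices; beyond that, \<open>n div 9\<close> is still at least \<open>r\<close>.\<close>
  define A :: real where "A = 11 / 8 * (9 * r + 9)"
  have "real (ex r (2 ^ n) 6) \<ge> 2 powr (11 / 8 * n - 17 * sqrt n - A)" if "n \<ge> r" for n
    using that
  proof (induction n rule: less_induct)
    case (less n)
    show ?case
    proof (cases "n < 9 * r + 9")
      case True
      have "real n \<le> 9 * real r + 9" using True by linarith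
      then have "11 / 8 * real n \<le> A" unfolding A_def by simp
      then have "11 / 8 * n - 17 * sqrt n - A \<le> 0" using real_sqrt_ge_zero[of "real n"] by linarith
      then have "2 powr (11 / 8 * n - 17 * sqrt n - A) \<le> 2 powr (0 :: real)" by (intro powr_mono) auto
      also have "\<dots> = 1" by simp
      also have "r \<le> 2 ^ n" using less.prems less_exp[of n] by linarith
      then have "1 \<le> ex r (2 ^ n) 6" using assms by (intro ex_pos) auto
      then have "1 \<le> real (ex r (2 ^ n) 6)" by linarith
      finally show ?thesis by simp
    next
      case False
      define m where "m = n div 9"
      have m: "9 * m \<le> n" "n \<le> 9 * m + 8" "m < n" "r \<le> m" "m > 0"
        using False unfolding m_def by linarith+
      have IH: "real (ex r (2 ^ m) 6) \<ge> 2 powr (11 / 8 * m - 17 * sqrt m - A)"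
        using less.IH m by auto
      \<comment> \<open>The remainder of at most 8 costs at most 11, while
        \<open>17 * (sqrt n - sqrt m)\<close> is at least 34.\<close>
      have "11 / 8 * n - 17 * sqrt n - A \<le> 11 * m + (11 / 8 * m - 17 * sqrt m - A)"
      proof -
        have "3 * sqrt m = sqrt (9 * m)" by (simp add: real_sqrt_mult)
        also have "\<dots> \<le> sqrt n" using m(1) by (intro real_sqrt_le_mono) linarith
        finally have "3 * sqrt m \<le> sqrt n" .
        moreover have "1 \<le> sqrt m" using m(5) by simp
        moreover have "real n \<le> 9 * real m + 8" using m(2) by linarith
        ultimately show ?thesis by linarith
      qed
      then have "2 powr (11 / 8 * n - 17 * sqrt n - A) \<le> 2 powr (11 * m + (11 / 8 * m - 17 * sqrt m - A))"
        by (intro powr_mono) auto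
      also have "\<dots> = 2 powr (11 * real m) * 2 powr (11 / 8 * m - 17 * sqrt m - A)"
        by (simp only: powr_add of_nat_mult of_nat_numeral)
      also have "2 powr (11 * real m) = real ((2 ^ m) ^ 11)"
        by (simp add: powr_realpow[symmetric] powr_powr mult.commute)
      also have "real ((2 ^ m) ^ 11) * 2 powr (11 / 8 * m - 17 * sqrt m - A) \<le> real ((2 ^ m) ^ 11) * real (ex r (2 ^ m) 6)"
        using IH by (intro mult_left_mono) auto
      also have "\<dots> = real ((2 ^ m) ^ 11 * ex r (2 ^ m) 6)" by simp
      also have "\<dots> \<le> real (ex r ((2 ^ m) ^ 9) 6)"
        using ex_ninth_power[OF m(5) assms] by (simp only: of_nat_le_iff)
      also have "ex r ((2 ^ m) ^ 9) 6 \<le> ex r (2 ^ n) 6"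
        using m(1) assms by (intro ex_mono) (auto simp: mult.commute simp flip: power_mult)
      finally show ?thesis by simp
    qed
  qed
  then show ?thesis by blast
qed

theorem theorem1:
  shows "\<exists>c::real. c > 0 \<and>
    (\<forall>r::nat. r \<ge> 2 \<longrightarrow>
      (\<exists>N0::nat. \<forall>N::nat. N \<ge> N0 \<longrightarrow>
        real (ex r N 6) \<ge> real N powr (11 / 8 - c / sqrt (log 2 (real N)))))"
proof (intro exI[of _ "18 :: real"] conjI allI impI)
  fix r :: nat assume r: "r \<ge> 2"
  then obtain A where A: "\<And>n. n \<ge> r \<Longrightarrow> real (ex r (2 ^ n) 6) \<ge> 2 powr (11 / 8 * n - 17 * sqrt n - A)"
    using ex_power2_lower_bound by blast
  \<comment> \<open>The 2 covers the loss of at most 11/8 from rounding \<open>L\<close> down to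
    \<open>n\<close>. The step from 17 to 18 square roots absorbs \<open>B\<close>, because
    \<open>L \<ge> B ^ 2\<close>.\<close>
  define B where "B = \<bar>A\<bar> + 2"
  define M where "M = nat \<lceil>B ^ 2\<rceil> + r + 1"
  have "real (ex r N 6) \<ge> real N powr (11 / 8 - 18 / sqrt (log 2 (real N)))" if N: "N \<ge> 2 ^ M" for N
  proof -
    define L where "L = log 2 (real N)"
    define n where "n = nat \<lfloor>L\<rfloor>"
    have "(2 :: real) ^ M \<le> real N" using N by (metis of_nat_le_iff of_nat_numeral of_nat_power)
    then have N0: "real N > 0" by (meson less_le_trans zero_less_numeral zero_less_power)
    have "real M \<le> L"
      unfolding L_def using \<open>2 ^ M \<le> real N\<close> N0 by (simp add: le_log_iff powr_realpow)
    then have L: "L \<ge> B ^ 2" "L \<ge> real r + 1" "L \<ge> 1" unfolding M_def by linarith+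
    have n: "real n \<le> L" "L \<le> real n + 1" "r \<le> n" using L unfolding n_def by linarith+
    have "2 ^ n \<le> N"
    proof -
      have "2 powr real n \<le> 2 powr L" using n by (intro powr_mono) auto
      also have "\<dots> = real N" using N0 by (simp add: L_def)
      finally have "real (2 ^ n) \<le> real N" by (simp add: powr_realpow)
      then show ?thesis by (simp only: of_nat_le_iff)
    qed
    have "real N powr (11 / 8 - 18 / sqrt L) = 2 powr (11 / 8 * L - 18 * sqrt L)"
    proof -
      have "L * (18 / sqrt L) = 18 * (L / sqrt L)" by simp
      also have "L / sqrt L = sqrt L" using L(3) by (simp add: real_div_sqrt)
      finally have "L * (11 / 8 - 18 / sqrt L) = 11 / 8 * L - 18 * sqrt L"
        by (simp only: right_diff_distrib mult.commute)
      moreover have "real N = 2 powr L" using N0 by (simp add: L_def)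
      ultimately show ?thesis by (simp add: powr_powr)
    qed
    also have "\<dots> \<le> 2 powr (11 / 8 * n - 17 * sqrt n - A)"
    proof (intro powr_mono)
      have "sqrt n \<le> sqrt L" using n by simp
      moreover have "B \<le> sqrt L" using L(1) by (intro real_le_rsqrt) simp
      moreover have "A + 2 \<le> B" unfolding B_def by linarith
      ultimately show "11 / 8 * L - 18 * sqrt L \<le> 11 / 8 * n - 17 * sqrt n - A" using n(2) by linarith
    qed simp
    also have "\<dots> \<le> real (ex r (2 ^ n) 6)" using A n(3) by blast
    also have "\<dots> \<le> real (ex r N 6)" using ex_mono[OF \<open>2 ^ n \<le> N\<close>] r by simp
    finally show ?thesis by (simp add: L_def)
  qed
  then show "\<exists>N0. \<forall>N\<ge>N0. real N powr (11 / 8 - 18 / sqrt (log 2 (real N))) \<le> real (ex r N 6)" by blast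
qed simp

end
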